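(* For all integers $n\geq 0$, $\overline{R_6^\ast}(9n+5)\equiv \overline{R_6^\ast}(9n+8)\equiv 0 \pmod{8}$.
   Context: An overpartition of $n$ is a partition of $n$ in which the first occurrence of each part size may optionally be overlined. For a positive integer $\ell$, $\overline{R_\ell^\ast}(n)$ denotes the number of overpartitions of $n$ in which no non-overlined part is divisible by $\ell$. Equivalently, with $f_k:=\prod_{i\geq 1}(1-q^{ki})$, one has $\sum_{n\geq 0}\overline{R_\ell^\ast}(n)q^n = \frac{f_2 f_\ell}{f_1^2}$. *)

theory Defs
  imports "HOL-Library.Multiset" "HOL-Number_Theory.Cong"
begin

definition is_partition :: "nat \<Rightarrow> nat multiset \<Rightarrow> bool" where
  "is_partition n P \<longleftrightarrow> 0 \<notin># P \<and> sum_mset P = n"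

(* An overpartition is encoded as a pair (P, S): P is the multiset of all part sizes,
   overlined or not, and S is the set of those sizes whose first occurrence is overlined. *)
definition overpartitions :: "nat \<Rightarrow> (nat multiset \<times> nat set) set" where
  "overpartitions n = {(P, S). is_partition n P \<and> S \<subseteq> set_mset P}"

(* Exactly one copy of each size in S is overlined; all other copies are not. *)
definition non_overlined :: "nat multiset \<times> nat set \<Rightarrow> nat multiset" where
  "non_overlined = (\<lambda>(P, S). P - mset_set S)"

definition R_star_bar :: "nat \<Rightarrow> nat \<Rightarrow> nat" where
  "R_star_bar l n =
     card {p \<in> overpartitions n. \<forall>k \<in># non_overlined p. \<not> l dvd k}"

(* card is 0 on infinite sets, so finiteness makes R_star_bar a genuine count. *)
lemma finite_overpartitions: "finite (overpartitions n)"
proof -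
  have sz: "size P \<le> sum_mset P" if "0 \<notin># P" for P :: "nat multiset"
    using that by (induction P) auto
  let ?M = "\<Union>m\<le>n. multisets_of_size {..n} m"
  have "finite ?M"
    by (intro finite_UN_I) auto
  moreover have "{P. is_partition n P} \<subseteq> ?M"
    using sz by (fastforce simp: is_partition_def multisets_of_size_def dest: multi_member_split)
  ultimately have "finite {P. is_partition n P}"
    by (rule rev_finite_subset)
  then have "finite (SIGMA P:{P. is_partition n P}. Pow (set_mset P))"
    by (intro finite_SigmaI) auto
  moreover have "overpartitions n = (SIGMA P:{P. is_partition n P}. Pow (set_mset P))"
    by (auto simp: overpartitions_def)
  ultimately show ?thesis by simp
qed

end

theory Submission
  imports Defs "HOL-Computational_Algebra.Formal_Power_Series" "HOL-Library.Disjoint_Sets"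
    "HOL-Library.Z2"
begin

text \<open>
  Gauss's identity turns the generating function $G = f_2 f_6 / f_1^2$ into
  $G \cdot (1 + 2\tau) = f_6$ with $\tau = \sum_{j \ge 1} (-1)^j q^{j^2}$, so that
  $G \equiv f_6\, (1 - 2\tau + 4\tau^2) \pmod 8$. Since $f_6$ is a series in $q^3$ and squares are
  $0$ or $1$ modulo $3$, only $4 f_6 \tau^2$ contributes to exponents $n \equiv 2 \pmod 3$. Modulo $2$,
  $\tau^2$ is $\sum_{j \ge 1} q^{2j^2}$ and, by Euler's pentagonal number theorem, $f_6$ is
  $\sum_{m \in Z} q^{3m(3m+1)}$. The coefficient of $q^n$ in their product counts the solutions of
  $3m(3m+1) + 2j^2 = n$, that is, of $x^2 + 2z^2 = 4n + 1$ with $x = 6m + 1$ and $z = 2j$. As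
  $4n + 1$ is divisible by $3$ but not by $9$, one can write, for the right sign of $z$,
  $x + z\sqrt{-2} = (1 + \sqrt{-2})(a + b\sqrt{-2})$, and $b \mapsto -b$ is a fixed-point-free
  involution on the solutions, so their number is even.

  Both theta identities are used in a finite form with telescoping proof, in the style of Shanks's
  proof of the pentagonal number theorem; the error terms are divisible by a high power of $q$, so
  no infinite products are needed.
\<close>

subsection \<open>Finite theta identities\<close>

text \<open>Truncation of Gauss's \<open>f_1^2 / f_2 = 1 + 2 * \<tau>\<close>: every summand of the
  error sum on the right is divisible by \<open>q ^ Suc n\<close>. Passing from \<open>n\<close> to
  \<open>Suc n\<close> multiplies the first product by \<open>1 + q ^ Suc n\<close> and adds one
  theta term; the effect on the error sum telescopes.\<close>

lemma gauss_square_finite: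
  fixes q :: "'a :: comm_ring_1"
  shows "(\<Prod>k\<in>{1..n}. 1 + q ^ k) * (1 + 2 * (\<Sum>j\<in>{1..n}. (-1) ^ j * q ^ j\<^sup>2)) =
    (\<Prod>k\<in>{1..n}. 1 - q ^ k) +
    2 * (\<Sum>s\<in>{1..n}. (-1) ^ s * q ^ (s * Suc n) * (\<Prod>k\<in>{1..<s}. 1 + q ^ k) * (\<Prod>k\<in>{s<..n}. 1 - q ^ k))"
proof (induction n)
  case 0
  show ?case by simp
next
  case (Suc n)
  define L where "L = (\<Prod>k\<in>{1..n}. 1 - q ^ k)"
  define M where "M = (\<Prod>k\<in>{1..n}. 1 + q ^ k)"
  define A where "A s = (\<Prod>k\<in>{1..<s}. 1 + q ^ k)" for s
  define B where "B s = (\<Prod>k\<in>{s<..n}. 1 - q ^ k)" for s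
  define C where "C s = (\<Prod>k\<in>{s..n}. 1 - q ^ k)" for s
  \<comment> \<open>Telescoping certificate: the \<open>s\<close>-th error summand at
    \<open>Suc n\<close>, minus \<open>1 + q ^ Suc n\<close> times the one at \<open>n\<close>, is
    \<open>u (Suc s) - u s\<close>.\<close>
  define u where "u s = (-1) ^ s * q ^ (s * Suc n) * A s * C s" for s
  have AS: "A (Suc s) = A s * (1 + q ^ s)" if "s \<ge> 1" for s
    using that by (simp add: A_def prod.atLeastLessThan_Suc)
  have CS: "C s = (1 - q ^ s) * B s" if "s \<le> n" for s
  proof -
    have "{s..n} = insert s {s<..n}" using that by auto
    then show ?thesis by (simp add: C_def B_def)
  qed
  have CB: "C (Suc s) = B s" for s
    by (simp add: C_def B_def atLeastSucAtMost_greaterThanAtMost)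
  have B_Suc: "(\<Prod>k\<in>{s<..Suc n}. 1 - q ^ k) = B s * (1 - q ^ Suc n)" if "s \<le> n" for s
  proof -
    have "{s<..Suc n} = insert (Suc n) {s<..n}" using that by auto
    then show ?thesis by (simp add: B_def mult.commute)
  qed
  have step: "(-1) ^ s * q ^ (s * Suc (Suc n)) * A s * (B s * (1 - q ^ Suc n)) -
        (1 + q ^ Suc n) * ((-1) ^ s * q ^ (s * Suc n) * A s * B s) = u (Suc s) - u s"
    if "s \<in> {1..n}" for s
  proof -
    have "q ^ (s * Suc (Suc n)) = q ^ (s * Suc n) * q ^ s"
         "q ^ (Suc s * Suc n) = q ^ (s * Suc n) * q ^ Suc n"
      by (simp_all add: algebra_simps flip: power_add)
    moreover have "(-1 :: 'a) ^ Suc s = - ((-1) ^ s)"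
      by simp
    ultimately show ?thesis
      using that by (simp add: u_def AS CS CB algebra_simps del: power_Suc mult_Suc mult_Suc_right)
  qed
  have "(\<Sum>s\<in>{1..n}. (-1) ^ s * q ^ (s * Suc (Suc n)) * A s * (B s * (1 - q ^ Suc n))) -
        (1 + q ^ Suc n) * (\<Sum>s\<in>{1..n}. (-1) ^ s * q ^ (s * Suc n) * A s * B s) =
        (\<Sum>s\<in>{1..n}. u (Suc s) - u s)"
    unfolding sum_distrib_left sum_subtractf [symmetric]
    by (intro sum.cong refl step)
  also have "\<dots> = u (Suc n) - u 1"
    by (induction n) auto
  also have "u (Suc n) = (-1) ^ Suc n * q ^ (Suc n * Suc n) * M"
    by (simp add: u_def A_def C_def M_def atLeastLessThanSuc_atLeastAtMost)
  also have "u 1 = - (q ^ Suc n * L)"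
    by (simp add: u_def A_def C_def L_def)
  finally have key: "(\<Sum>s\<in>{1..n}. (-1) ^ s * q ^ (s * Suc (Suc n)) * A s * (B s * (1 - q ^ Suc n))) =
     (1 + q ^ Suc n) * (\<Sum>s\<in>{1..n}. (-1) ^ s * q ^ (s * Suc n) * A s * B s) +
     (-1) ^ Suc n * q ^ (Suc n * Suc n) * M + q ^ Suc n * L"
    by (simp add: algebra_simps)
  define T where "T = (\<Sum>s\<in>{1..n}. (-1) ^ s * q ^ (s * Suc n) * A s * B s)"
  define Q where "Q = q ^ Suc n"
  define R where "R = (-1) ^ Suc n * q ^ (Suc n * Suc n)"
  define U where "U = (\<Sum>j\<in>{1..n}. (-1) ^ j * q ^ j\<^sup>2)"
  have IH: "M * (1 + 2 * U) = L + 2 * T"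
    using Suc by (simp add: M_def U_def L_def T_def A_def B_def)
  have "(\<Sum>s\<in>{1..Suc n}. (-1) ^ s * q ^ (s * Suc (Suc n)) * A s * (\<Prod>k\<in>{s<..Suc n}. 1 - q ^ k)) =
    (\<Sum>s\<in>{1..n}. (-1) ^ s * q ^ (s * Suc (Suc n)) * A s * (B s * (1 - q ^ Suc n))) +
    (-1) ^ Suc n * q ^ (Suc n * Suc (Suc n)) * A (Suc n)"
    by (simp add: B_Suc)
  also have "A (Suc n) = M"
    by (simp add: A_def M_def atLeastLessThanSuc_atLeastAtMost)
  also have "q ^ (Suc n * Suc (Suc n)) = q ^ (Suc n * Suc n) * Q"
    by (simp add: Q_def algebra_simps flip: power_add)
  finally have sum_eq: "(\<Sum>s\<in>{1..Suc n}. (-1) ^ s * q ^ (s * Suc (Suc n)) * A s * (\<Prod>k\<in>{s<..Suc n}. 1 - q ^ k)) =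
    (1 + Q) * T + R * M + Q * L + R * Q * M"
    unfolding key T_def [symmetric] by (simp add: Q_def R_def algebra_simps)
  have "(\<Prod>k\<in>{1..Suc n}. 1 + q ^ k) * (1 + 2 * (\<Sum>j\<in>{1..Suc n}. (-1) ^ j * q ^ j\<^sup>2)) =
    (1 + Q) * M * (1 + 2 * U + 2 * R)"
    by (simp add: Q_def M_def U_def R_def power2_eq_square algebra_simps)
  also have "\<dots> = (1 + Q) * (M * (1 + 2 * U)) + (1 + Q) * M * 2 * R"
    by (simp add: algebra_simps)
  \<comment> \<open>The boundary value \<open>u (Suc n)\<close> and the new summand
    \<open>s = Suc n\<close> give \<open>R * M + R * Q * M\<close>, which absorbs the new theta
    term. Twice the term \<open>Q * L\<close> coming from \<open>u 1\<close> is the difference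
    between \<open>(1 + Q) * L\<close> and \<open>(1 - Q) * L\<close>.\<close>
  also have "\<dots> = (1 - Q) * L + 2 * ((1 + Q) * T + R * M + Q * L + R * Q * M)"
    unfolding IH by (simp add: algebra_simps)
  also have "(1 - Q) * L = (\<Prod>k\<in>{1..Suc n}. 1 - q ^ k)"
    by (simp add: Q_def L_def mult.commute)
  finally show ?case
    unfolding sum_eq [symmetric] A_def .
qed

text \<open>Shanks's truncation of Euler's theorem: the summand \<open>s = 0\<close> on the right is
  the full product. In the induction the right side grows by two powers of \<open>q\<close> up to
  sign, one left over from telescoping and one from the new summand
  \<open>s = Suc n\<close>.\<close>

lemma shanks_pentagonal:
  fixes q :: "'a :: comm_ring_1"
  shows "1 + (\<Sum>k\<in>{1..n}. (-1) ^ k * (q ^ (k * (3 * k - 1) div 2) + q ^ (k * (3 * k + 1) div 2))) =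
    (\<Sum>s\<in>{0..n}. (-1) ^ s * q ^ (s * n + s * (s + 1) div 2) * (\<Prod>k\<in>{s<..n}. 1 - q ^ k))"
proof (induction n)
  case 0
  show ?case by simp
next
  case (Suc n)
  define B where "B s = (\<Prod>k\<in>{s<..n}. 1 - q ^ k)" for s
  define C where "C s = (\<Prod>k\<in>{s..n}. 1 - q ^ k)" for s
  \<comment> \<open>Raising \<open>n\<close> by one changes the \<open>s\<close>-th summand by
    \<open>v (Suc s) - v s\<close>. At the lower end \<open>v 0 = 0\<close>, because
    \<open>C 0\<close> contains the factor \<open>1 - q ^ 0\<close>.\<close>
  define v where "v s = (-1) ^ s * q ^ (s * n + s * (s + 1) div 2) * C s" for s
  have CS: "C s = (1 - q ^ s) * B s" if "s \<le> n" for s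
  proof -
    have "{s..n} = insert s {s<..n}" using that by auto
    then show ?thesis by (simp add: C_def B_def)
  qed
  have CB: "C (Suc s) = B s" for s
    by (simp add: C_def B_def atLeastSucAtMost_greaterThanAtMost)
  have B_Suc: "(\<Prod>k\<in>{s<..Suc n}. 1 - q ^ k) = B s * (1 - q ^ Suc n)" if "s \<le> n" for s
  proof -
    have "{s<..Suc n} = insert (Suc n) {s<..n}" using that by auto
    then show ?thesis by (simp add: B_def mult.commute)
  qed
  have step: "(-1) ^ s * q ^ (s * Suc n + s * (s + 1) div 2) * (B s * (1 - q ^ Suc n)) =
      (-1) ^ s * q ^ (s * n + s * (s + 1) div 2) * B s + (v (Suc s) - v s)"
    if "s \<in> {0..n}" for s
  proof -
    have "Suc s * n + Suc s * (Suc s + 1) div 2 = (s * n + s * (s + 1) div 2) + Suc n + s"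
      by simp
    then have "q ^ (Suc s * n + Suc s * (Suc s + 1) div 2) = q ^ (s * n + s * (s + 1) div 2) * q ^ Suc n * q ^ s"
      by (simp only: power_add)
    moreover have "q ^ (s * Suc n + s * (s + 1) div 2) = q ^ (s * n + s * (s + 1) div 2) * q ^ s"
      by (simp add: algebra_simps flip: power_add)
    moreover have "(-1 :: 'a) ^ Suc s = - ((-1) ^ s)"
      by simp
    ultimately show ?thesis
      using that by (simp add: v_def CS CB algebra_simps del: power_Suc mult_Suc mult_Suc_right)
  qed
  have "(\<Sum>s\<in>{0..Suc n}. (-1) ^ s * q ^ (s * Suc n + s * (s + 1) div 2) * (\<Prod>k\<in>{s<..Suc n}. 1 - q ^ k)) =
    (\<Sum>s\<in>{0..n}. (-1) ^ s * q ^ (s * Suc n + s * (s + 1) div 2) * (B s * (1 - q ^ Suc n))) +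
    (-1) ^ Suc n * q ^ (Suc n * Suc n + Suc n * (Suc n + 1) div 2)"
    by (simp add: B_Suc)
  also have "(\<Sum>s\<in>{0..n}. (-1) ^ s * q ^ (s * Suc n + s * (s + 1) div 2) * (B s * (1 - q ^ Suc n))) =
    (\<Sum>s\<in>{0..n}. (-1) ^ s * q ^ (s * n + s * (s + 1) div 2) * B s) + (\<Sum>s\<in>{0..n}. v (Suc s) - v s)"
    unfolding sum.distrib [symmetric] by (intro sum.cong refl step)
  also have "(\<Sum>s\<in>{0..n}. v (Suc s) - v s) = v (Suc n) - v 0"
    by (induction n) auto
  also have "v 0 = 0"
    by (simp add: v_def CS)
  also have "v (Suc n) = (-1) ^ Suc n * q ^ (Suc n * n + Suc n * (Suc n + 1) div 2)"
    by (simp add: v_def C_def)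
  also have "Suc n * n + Suc n * (Suc n + 1) div 2 = Suc n * (3 * Suc n - 1) div 2"
  proof -
    have "2 * (Suc n * n) + Suc n * (Suc n + 1) = Suc n * (3 * Suc n - 1)"
      by (simp add: algebra_simps)
    then show ?thesis by simp
  qed
  also have "Suc n * Suc n + Suc n * (Suc n + 1) div 2 = Suc n * (3 * Suc n + 1) div 2"
  proof -
    have "2 * (Suc n * Suc n) + Suc n * (Suc n + 1) = Suc n * (3 * Suc n + 1)"
      by (simp add: algebra_simps)
    then show ?thesis by simp
  qed
  also have "(\<Sum>s\<in>{0..n}. (-1) ^ s * q ^ (s * n + s * (s + 1) div 2) * B s) =
    1 + (\<Sum>k\<in>{1..n}. (-1) ^ k * (q ^ (k * (3 * k - 1) div 2) + q ^ (k * (3 * k + 1) div 2)))"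
    using Suc by (simp add: B_def)
  finally show ?case
    by (simp add: algebra_simps)
qed

lemma sum_symmetric_int_interval:
  fixes f :: "int \<Rightarrow> 'a :: comm_monoid_add"
  shows "(\<Sum>m\<in>{- int n..int n}. f m) = f 0 + (\<Sum>k\<in>{1..n}. f (- int k) + f (int k))"
proof (induction n)
  case 0
  show ?case by simp
next
  case (Suc n)
  have "{- int (Suc n)..int (Suc n)} = insert (- int (Suc n)) (insert (int (Suc n)) {- int n..int n})"
    by auto
  then show ?case
    using Suc by (simp add: ac_simps)
qed

text \<open>Modulo \<open>q ^ Suc n\<close> only the summand \<open>s = 0\<close> of
  \<open>shanks_pentagonal\<close> survives. Its two families of exponents merge into one sum over
  integers, with \<open>m = - k\<close> and \<open>m = k\<close>.\<close>

lemma pentagonal_mod_power: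
  fixes q :: "'a :: comm_ring_1"
  shows "q ^ Suc n dvd
    (\<Sum>m\<in>{- int n..int n}. (-1) ^ nat \<bar>m\<bar> * q ^ nat (m * (3 * m + 1) div 2)) -
    (\<Prod>k\<in>{1..n}. 1 - q ^ k)"
proof -
  let ?t = "\<lambda>s. (-1) ^ s * q ^ (s * n + s * (s + 1) div 2) * (\<Prod>k\<in>{s<..n}. 1 - q ^ k)"
  have "nat (- int k * (3 * (- int k) + 1) div 2) = k * (3 * k - 1) div 2" if "k \<ge> 1" for k
  proof -
    have "- int k * (3 * (- int k) + 1) = int (k * (3 * k - 1))"
      using that by (simp add: of_nat_diff algebra_simps)
    then show ?thesis
      by (metis nat_int of_nat_numeral zdiv_int)
  qed
  moreover have "nat (int k * (3 * int k + 1) div 2) = k * (3 * k + 1) div 2" for k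
  proof -
    have "int k * (3 * int k + 1) = int (k * (3 * k + 1))"
      by (simp add: algebra_simps)
    then show ?thesis
      by (metis nat_int of_nat_numeral zdiv_int)
  qed
  ultimately have "(\<Sum>m\<in>{- int n..int n}. (-1) ^ nat \<bar>m\<bar> * q ^ nat (m * (3 * m + 1) div 2)) =
     1 + (\<Sum>k\<in>{1..n}. (-1) ^ k * (q ^ (k * (3 * k - 1) div 2) + q ^ (k * (3 * k + 1) div 2)))"
    unfolding sum_symmetric_int_interval
    by (auto simp: distrib_left intro!: sum.cong)
  also have "\<dots> = (\<Sum>s\<in>{0..n}. ?t s)"
    by (rule shanks_pentagonal)
  also have "\<dots> = (\<Prod>k\<in>{1..n}. 1 - q ^ k) + (\<Sum>s\<in>{1..n}. ?t s)"
    by (simp add: sum.atLeast_Suc_atMost atLeastSucAtMost_greaterThanAtMost)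
  finally have "(\<Sum>m\<in>{- int n..int n}. (-1) ^ nat \<bar>m\<bar> * q ^ nat (m * (3 * m + 1) div 2)) -
      (\<Prod>k\<in>{1..n}. 1 - q ^ k) = (\<Sum>s\<in>{1..n}. ?t s)"
    by simp
  moreover have "q ^ Suc n dvd (\<Sum>s\<in>{1..n}. ?t s)"
  proof (rule dvd_sum)
    fix s assume s: "s \<in> {1..n}"
    have "1 * n \<le> s * n" "1 * 2 \<le> s * (s + 1)"
      by (intro mult_le_mono; use s in simp)+
    moreover from this(2) have "1 \<le> s * (s + 1) div 2"
      using div_le_mono[of 2 "s * (s + 1)" 2] by simp
    ultimately have "Suc n \<le> s * n + s * (s + 1) div 2"
      by linarith
    then show "q ^ Suc n dvd ?t s"
      by (intro dvd_mult2 dvd_mult le_imp_power_dvd)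
  qed
  ultimately show ?thesis
    by (simp only:)
qed

lemma gauss_square_mod_power:
  fixes q :: "'a :: comm_ring_1"
  shows "q ^ Suc n dvd
    (\<Prod>k\<in>{1..n}. 1 + q ^ k) * (1 + 2 * (\<Sum>j\<in>{1..n}. (-1) ^ j * q ^ j\<^sup>2)) - (\<Prod>k\<in>{1..n}. 1 - q ^ k)"
proof -
  have "q ^ Suc n dvd q ^ (s * Suc n)" if "s \<in> {1..n}" for s
  proof (rule le_imp_power_dvd)
    show "Suc n \<le> s * Suc n"
      using that by (cases s) simp_all
  qed
  then show ?thesis
    unfolding gauss_square_finite add_diff_cancel_left'
    by (intro dvd_mult dvd_sum dvd_mult2) auto
qed

subsection \<open>The generating function\<close>

text \<open>Removing the overlined copies leaves the multiset \<open>M\<close> of non-overlined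
  parts. The constraint tying \<open>S\<close> to \<open>P\<close> disappears, so \<open>M\<close>
  and \<open>S\<close> vary independently and the generating function factors.\<close>

lemma R_star_bar_eq_card_pairs:
  "R_star_bar l n = card {(M, S). finite S \<and> 0 \<notin> S \<and> 0 \<notin># M \<and> (\<forall>k\<in>#M. \<not> l dvd k) \<and>
     sum_mset M + \<Sum>S = n}"
proof -
  have sub: "mset_set S \<subseteq># P" if "S \<subseteq> set_mset P" for S :: "nat set" and P
    using that by (meson mset_set_set_mset_msubset finite_set_mset subset_imp_msubset_mset_set
        subset_mset.order_trans)
  have sum_ms: "sum_mset (mset_set S) = \<Sum>S" for S :: "nat set"
    by (simp add: sum_unfold_sum_mset)
  have "bij_betw (\<lambda>(P, S). (P - mset_set S, S))
      {p \<in> overpartitions n. \<forall>k\<in>#non_overlined p. \<not> l dvd k}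
      {(M, S). finite S \<and> 0 \<notin> S \<and> 0 \<notin># M \<and> (\<forall>k\<in>#M. \<not> l dvd k) \<and> sum_mset M + \<Sum>S = n}"
  proof (rule bij_betw_byWitness[where f' = "\<lambda>(M, S). (M + mset_set S, S)"], goal_cases)
    case 1
    then show ?case
      using sub by (auto simp: overpartitions_def)
  next
    case 2
    then show ?case by auto
  next
    case 3
    have "sum_mset (P - mset_set S) + \<Sum>S = sum_mset P" if "S \<subseteq> set_mset P" for P and S :: "nat set"
      by (metis sub[OF that] subset_mset.diff_add sum_mset.union sum_ms)
    then show ?case
      by (auto simp: overpartitions_def is_partition_def non_overlined_def
          dest: in_diffD finite_subset[OF _ finite_set_mset])
  next
    case 4
    have "S \<subseteq> set_mset (M + mset_set S)" if "finite S" for M and S :: "nat set"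
      using that by simp
    then show ?case
      by (clarsimp simp: overpartitions_def is_partition_def non_overlined_def sum_ms)
  qed
  then show ?thesis
    unfolding R_star_bar_def by (rule bij_betw_same_card)
qed

text \<open>For finite \<open>A\<close> without 0 this is the reciprocal of the product of
  \<open>1 - fps_X ^ k\<close> over \<open>A\<close>; it enters through
  \<open>partition_fps_mult_prod\<close>, which avoids inverses of series.\<close>

definition partition_fps :: "nat set \<Rightarrow> int fps" where
  "partition_fps A = Abs_fps (\<lambda>i. int (card {M. set_mset M \<subseteq> A \<and> sum_mset M = i}))"

lemma finite_msets_sum:
  fixes A :: "nat set"
  assumes "0 \<notin> A"
  shows "finite {M. set_mset M \<subseteq> A \<and> sum_mset M = i}"
proof (rule finite_subset)
  show "{M. set_mset M \<subseteq> A \<and> sum_mset M = i} \<subseteq> fst ` overpartitions i"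
    using assms by (force simp: overpartitions_def is_partition_def image_iff)
qed (simp add: finite_overpartitions)

lemma partition_fps_insert:
  assumes "0 \<notin> A" "k > 0" "k \<notin> A"
  shows "partition_fps (insert k A) * (1 - fps_X ^ k) = partition_fps A"
proof (rule fps_ext)
  fix n
  let ?Q = "\<lambda>A i. {M. set_mset M \<subseteq> A \<and> sum_mset M = i}"
  \<comment> \<open>\<open>R\<close> collects the multisets that contain \<open>k\<close>, each
    obtained by adding one \<open>k\<close>. The case \<open>n < k\<close> is separate because
    \<open>n - k\<close> would be truncated to 0.\<close>
  define R where "R = (if n < k then {} else add_mset k ` ?Q (insert k A) (n - k))"
  have union: "?Q (insert k A) n = ?Q A n \<union> R"
  proof (intro equalityI subsetI)
    fix M assume M: "M \<in> ?Q (insert k A) n"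
    show "M \<in> ?Q A n \<union> R"
    proof (cases "k \<in># M")
      case True
      then obtain M' where "M = add_mset k M'"
        by (meson multi_member_split)
      with M show ?thesis by (auto simp: R_def)
    next
      case False
      with M show ?thesis by auto
    qed
  next
    fix M assume "M \<in> ?Q A n \<union> R"
    then show "M \<in> ?Q (insert k A) n"
      by (auto simp: R_def split: if_splits)
  qed
  have fin: "finite (?Q A n)" "finite R"
    unfolding R_def using assms by (auto intro!: finite_msets_sum)
  have disjoint: "?Q A n \<inter> R = {}"
  proof (rule equals0I)
    fix M assume "M \<in> ?Q A n \<inter> R"
    then have "set_mset M \<subseteq> A" "M \<in> R" by simp_all
    then have "k \<notin># M" "k \<in># M"
      using \<open>k \<notin> A\<close> by (auto simp: R_def split: if_splits)
    then show False by simp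
  qed
  have "card (?Q (insert k A) n) = card (?Q A n) + card R"
    unfolding union by (rule card_Un_disjoint[OF fin disjoint])
  also have "card R = (if n < k then 0 else card (?Q (insert k A) (n - k)))"
    by (simp add: R_def card_image inj_on_def)
  finally have "int (card (?Q (insert k A) n)) =
      int (card (?Q A n)) + (if n < k then 0 else int (card (?Q (insert k A) (n - k))))"
    by simp
  then show "fps_nth (partition_fps (insert k A) * (1 - fps_X ^ k)) n = fps_nth (partition_fps A) n"
    by (simp add: partition_fps_def right_diff_distrib fps_X_power_mult_right_nth)
qed

lemma partition_fps_mult_prod:
  assumes "finite A" "0 \<notin> A"
  shows "partition_fps A * (\<Prod>k\<in>A. 1 - fps_X ^ k) = 1"
  using assms
proof (induction A)
  case empty
  have "{M. set_mset M \<subseteq> {} \<and> sum_mset M = i} = (if i = 0 then {{#}} else {})" for i :: nat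
    by auto
  then show ?case
    by (intro fps_ext) (simp add: partition_fps_def)
next
  case (insert k A)
  have "partition_fps (insert k A) * (\<Prod>i\<in>insert k A. 1 - fps_X ^ i) =
      (partition_fps (insert k A) * (1 - fps_X ^ k)) * (\<Prod>i\<in>A. 1 - fps_X ^ i)"
    using insert.hyps by (simp add: mult.assoc)
  also have "\<dots> = 1"
    using insert by (subst partition_fps_insert) auto
  finally show ?case .
qed

lemma fps_nth_prod_one_plus_X_power:
  assumes "finite A"
  shows "fps_nth (\<Prod>k\<in>A. 1 + fps_X ^ k :: int fps) n = int (card {S. S \<subseteq> A \<and> \<Sum>S = n})"
proof -
  have "(\<Prod>k\<in>A. 1 + fps_X ^ k :: int fps) = (\<Prod>k\<in>A. fps_X ^ k + 1)"
    by (simp add: add.commute)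
  also have "\<dots> = (\<Sum>S\<in>Pow A. fps_X ^ (\<Sum>S))"
    by (simp add: prod_add[OF assms] power_sum)
  finally show ?thesis
    using assms by (simp add: fps_sum_nth sum.If_cases Int_def conj_commute eq_commute)
qed

text \<open>No part exceeds \<open>n \<le> N\<close>, so finite products up to \<open>N\<close>
  already give the exact coefficient. Splitting by the sum \<open>i\<close> of the overlined parts
  yields the Cauchy product.\<close>

lemma R_star_bar_eq_fps_nth:
  assumes "n \<le> N"
  shows "int (R_star_bar l n) =
    fps_nth ((\<Prod>k\<in>{1..N}. 1 + fps_X ^ k) * partition_fps {k \<in> {1..N}. \<not> l dvd k}) n"
proof -
  define A where "A = {k \<in> {1..N}. \<not> l dvd k}"
  define QS where "QS i = {S. S \<subseteq> {1..N} \<and> \<Sum>S = i}" for i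
  define QM where "QM i = {M. set_mset M \<subseteq> A \<and> sum_mset M = i}" for i
  have mem_S: "k \<le> \<Sum>S" if "finite S" "k \<in> S" for k :: nat and S
    using member_le_sum[of k S "\<lambda>x. x"] that by simp
  have mem_M: "k \<le> sum_mset M" if "k \<in># M" for k :: nat and M
    using multi_member_split[OF that] by auto
  have fin: "finite (QS i)" "finite (QM i)" for i
    by (auto simp: QS_def QM_def A_def intro: finite_msets_sum)
  have "{(M, S). finite S \<and> 0 \<notin> S \<and> 0 \<notin># M \<and> (\<forall>k\<in>#M. \<not> l dvd k) \<and> sum_mset M + \<Sum>S = n} =
      (\<Union>i\<in>{0..n}. QM (n - i) \<times> QS i)" (is "?L = ?R")
  proof (intro equalityI subsetI)
    fix p assume "p \<in> ?L"
    then obtain M S where p: "p = (M, S)" "finite S" "0 \<notin> S" "0 \<notin># M" "\<forall>k\<in>#M. \<not> l dvd k"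
        "sum_mset M + \<Sum>S = n"
      by auto
    have "S \<subseteq> {1..N}"
      using p mem_S[of S] assms by (force simp: Suc_le_eq intro: gr0I)
    moreover have "set_mset M \<subseteq> A"
      using p mem_M[of _ M] assms by (force simp: Suc_le_eq A_def intro: gr0I)
    ultimately show "p \<in> ?R"
      using p by (auto simp: QM_def QS_def intro!: bexI[of _ "\<Sum>S"])
  next
    fix p assume "p \<in> ?R"
    then show "p \<in> ?L"
      by (auto simp: QM_def QS_def A_def dest: finite_subset)
  qed
  then have "R_star_bar l n = card (\<Union>i\<in>{0..n}. QM (n - i) \<times> QS i)"
    by (simp add: R_star_bar_eq_card_pairs)
  also have "\<dots> = (\<Sum>i\<in>{0..n}. card (QM (n - i) \<times> QS i))"
    using fin by (intro card_UN_disjoint) (auto simp: QS_def)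
  finally show ?thesis
    unfolding A_def [symmetric]
    by (simp add: fps_mult_nth fps_nth_prod_one_plus_X_power partition_fps_def
        card_cartesian_product QS_def QM_def mult.commute)
qed

lemma prod_one_minus_multiples:
  fixes q :: "'a :: comm_ring_1"
  assumes "l > 0"
  shows "(\<Prod>k\<in>{k \<in> {1..N}. l dvd k}. 1 - q ^ k) = (\<Prod>j\<in>{1..N div l}. 1 - (q ^ l) ^ j)"
proof (rule sym, rule prod.reindex_bij_witness[where i = "\<lambda>k. k div l" and j = "\<lambda>j. l * j"], goal_cases)
  case (2 j)
  then have "l * j \<le> l * (N div l)" by simp
  also have "\<dots> \<le> N" by simp
  finally show ?case using 2 assms by simp
next
  case (4 k)
  then show ?case
    using assms by (auto simp: div_le_mono Suc_le_eq div_greater_zero_iff dvd_imp_le)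
qed (use assms in \<open>auto simp: power_mult\<close>)

text \<open>This is \<open>G * \<theta> = f_l\<close> modulo \<open>fps_X ^ Suc N\<close>. Gauss's
  identity replaces \<open>M * \<theta>\<close> by \<open>L\<close>, multiplication by
  \<open>P\<close> cancels the factors of \<open>L\<close> with \<open>k\<close> not divisible by
  \<open>l\<close>, and the pentagonal theorem in \<open>fps_X ^ l\<close> turns the remaining
  product \<open>F\<close> into \<open>E\<close>.\<close>

lemma R_star_bar_generating_function_mod:
  fixes l N :: nat
  assumes "l > 0"
  defines "\<theta> \<equiv> 1 + 2 * (\<Sum>j\<in>{1..N}. (-1) ^ j * fps_X ^ j\<^sup>2) :: int fps"
  defines "g \<equiv> (\<Prod>k\<in>{1..N}. 1 + fps_X ^ k) * partition_fps {k \<in> {1..N}. \<not> l dvd k}"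
  defines "E \<equiv> (\<Sum>m\<in>{- int (N div l)..int (N div l)}.
    (-1) ^ nat \<bar>m\<bar> * (fps_X ^ l) ^ nat (m * (3 * m + 1) div 2)) :: int fps"
  shows "fps_X ^ Suc N dvd g * \<theta> - E"
proof -
  define M where "M = (\<Prod>k\<in>{1..N}. 1 + fps_X ^ k :: int fps)"
  define L where "L = (\<Prod>k\<in>{1..N}. 1 - fps_X ^ k :: int fps)"
  define P where "P = partition_fps {k \<in> {1..N}. \<not> l dvd k}"
  define F where "F = (\<Prod>k\<in>{k \<in> {1..N}. l dvd k}. 1 - fps_X ^ k :: int fps)"
  have "L = (\<Prod>k\<in>{k \<in> {1..N}. \<not> l dvd k} \<union> {k \<in> {1..N}. l dvd k}. 1 - fps_X ^ k)"
    unfolding L_def by (intro prod.cong) auto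
  also have "\<dots> = (\<Prod>k\<in>{k \<in> {1..N}. \<not> l dvd k}. 1 - fps_X ^ k) * F"
    unfolding F_def by (intro prod.union_disjoint) auto
  finally have "L = (\<Prod>k\<in>{k \<in> {1..N}. \<not> l dvd k}. 1 - fps_X ^ k) * F" .
  moreover have "P * (\<Prod>k\<in>{k \<in> {1..N}. \<not> l dvd k}. 1 - fps_X ^ k) = 1"
    unfolding P_def by (intro partition_fps_mult_prod) auto
  ultimately have PL: "P * L = F"
    by (simp flip: mult.assoc)
  have "fps_X ^ Suc N dvd (M * \<theta> - L) * P"
    unfolding M_def \<theta>_def L_def by (intro dvd_mult2 gauss_square_mod_power)
  also have "(M * \<theta> - L) * P = g * \<theta> - F"
    unfolding PL [symmetric] by (simp add: g_def M_def P_def algebra_simps)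
  finally have 1: "fps_X ^ Suc N dvd g * \<theta> - F" .
  \<comment> \<open>Truncating the pentagonal sum at \<open>N div l\<close> is enough, as its error
    is divisible by \<open>fps_X\<close> to the power \<open>l * Suc (N div l)\<close>.\<close>
  have "Suc N \<le> l * Suc (N div l)"
    using assms(1) by (metis Suc_leI dividend_less_times_div mult_Suc_right add.commute)
  then have "(fps_X :: int fps) ^ Suc N dvd (fps_X ^ l) ^ Suc (N div l)"
    unfolding power_mult [symmetric] by (rule le_imp_power_dvd)
  also have "(fps_X ^ l) ^ Suc (N div l) dvd E - F"
    unfolding E_def F_def prod_one_minus_multiples[OF assms(1)] by (rule pentagonal_mod_power)
  finally have "fps_X ^ Suc N dvd E - F" .
  from dvd_diff[OF 1 this] show ?thesis by simp
qed

subsection \<open>Parity of the number of representations\<close>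

text \<open>In characteristic 2 the terms at \<open>x\<close> and \<open>h x\<close> cancel. For
  infinite \<open>X\<close>, \<open>card X\<close> is 0.\<close>

lemma even_card_involution:
  assumes "\<And>x. x \<in> X \<Longrightarrow> h x \<in> X" "\<And>x. x \<in> X \<Longrightarrow> h (h x) = x" "\<And>x. x \<in> X \<Longrightarrow> h x \<noteq> x"
  shows "even (card X)"
proof -
  have "(\<Sum>x\<in>X. 1 :: bit) = 0"
    using assms by (intro sum_involution_eq_0[where h = h]) auto
  then have "of_nat (card X) = (0 :: bit)"
    by simp
  moreover have "of_nat n = (0 :: bit) \<longleftrightarrow> even n" for n
    by (induction n) auto
  ultimately show ?thesis
    by simp
qed

text \<open>The equation says \<open>x^2 + 8 * y^2 = 4 * n + 1\<close> with
  \<open>x = 6 * m + 1\<close> and \<open>y = 3 * k + 2\<close>, and the hypothesis says that 3 but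
  not 9 divides \<open>4 * n + 1\<close>. A fixed point of the involution would need
  \<open>x = 2 * y\<close> or \<open>x = - 4 * y\<close>, but \<open>x\<close> is odd.\<close>

lemma even_card_form_solutions:
  fixes n :: nat
  assumes n: "n mod 9 = 5 \<or> n mod 9 = 8"
  shows "even (card {(m :: int, k :: int). 3 * m * (3 * m + 1) + 2 * (3 * k + 2)\<^sup>2 = int n})"
    (is "even (card ?Y)")
proof -
  \<comment> \<open>With $x = 6m + 1$ and $y = 3k + 2$, the involution is $(x, y) \mapsto \pm((8y - x)/3, (x + y)/3)$,
    the sign being chosen so that the congruences on $x$ and $y$ are preserved.\<close>
  define h :: "int \<times> int \<Rightarrow> int \<times> int" where
    "h = (\<lambda>(m, k). if (m - k) mod 3 = 2 then ((4 * k + 2 - m) div 3, (2 * m + k - 1) div 3)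
       else ((m - 4 * k - 3) div 3, (- 2 * m - k - 3) div 3))"
  \<comment> \<open>In the coordinates \<open>(k, t)\<close> no division remains: \<open>h1\<close>
    sends \<open>t\<close> to \<open>- t - 1\<close> and \<open>k\<close> to
    \<open>k + 2 * t + 1\<close>, while \<open>h2\<close> fixes \<open>t\<close> and sends
    \<open>k\<close> to \<open>- k - 2 * t - 1\<close>. Both are visibly involutions.\<close>
  have h1: "h (k + 3 * t + 2, k) = (k - t, k + 2 * t + 1)" for k t
    by (simp add: h_def)
  have h2: "h (k + 3 * t, k) = (t - k - 1, - k - 2 * t - 1)" for k t
    by (simp add: h_def)
  \<comment> \<open>In the remaining class \<open>(x + y) / 3 = 2 * m + k + 1\<close> would be
    divisible by 3, so neither sign would work; there \<open>n\<close> is 2 modulo 9.\<close>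
  have h3: "(\<exists>t. m = k + 3 * t) \<or> (\<exists>t. m = k + 3 * t + 2)" if "(m, k) \<in> ?Y" for m k
  proof -
    have "m \<noteq> k + 3 * t + 1" for t
    proof
      assume "m = k + 3 * t + 1"
      then have "int n = 9 * (m\<^sup>2 + 2 * k\<^sup>2 + 3 * k + t + 1) + 2"
        using that by (simp add: power2_eq_square algebra_simps)
      then obtain c where "int n = 9 * c + 2" ..
      then show False
        using n by presburger
    qed
    then show ?thesis by presburger
  qed
  show ?thesis
  proof (rule even_card_involution[where h = h])
    fix p assume p: "p \<in> ?Y"
    then obtain m k where mk: "p = (m, k)" by auto
    consider t where "m = k + 3 * t" | t where "m = k + 3 * t + 2"
      using h3 p mk by blast
    then have "h p \<in> ?Y \<and> h (h p) = p \<and> h p \<noteq> p"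
    proof cases
      case 1
      have "h (t - k - 1, - k - 2 * t - 1) = (k + 3 * t, k)"
        using h2[of "- k - 2 * t - 1" t] by (simp add: algebra_simps)
      moreover have "h p = (t - k - 1, - k - 2 * t - 1)"
        using 1 mk h2 by simp
      moreover have "t - k - 1 \<noteq> k + 3 * t" by presburger
      moreover have "(t - k - 1, - k - 2 * t - 1) \<in> ?Y"
        using p mk 1 by (simp add: power2_eq_square algebra_simps)
      ultimately show ?thesis
        using 1 mk by simp
    next
      case 2
      have "h (k - t, k + 2 * t + 1) = (k + 3 * t + 2, k)"
        using h1[of "k + 2 * t + 1" "- t - 1"] by simp
      moreover have "h p = (k - t, k + 2 * t + 1)"
        using 2 mk h1 by simp
      moreover have "k - t \<noteq> k + 3 * t + 2" by presburger
      moreover have "(k - t, k + 2 * t + 1) \<in> ?Y"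
        using p mk 2 by (simp add: power2_eq_square algebra_simps)
      ultimately show ?thesis
        using 2 mk by simp
    qed
    then show "h p \<in> ?Y" "h (h p) = p" "h p \<noteq> p" by auto
  qed
qed

text \<open>Moves the parity to the index set of the coefficient. Since 3 does not divide
  \<open>n\<close>, it does not divide \<open>j\<close>, so exactly one of \<open>j\<close> and
  \<open>- j\<close> has the form \<open>3 * k + 2\<close>. The bounds on \<open>m\<close> and
  \<open>j\<close> follow from the equation.\<close>

lemma even_card_natural_solutions:
  fixes n :: nat
  assumes n: "n mod 9 = 5 \<or> n mod 9 = 8"
  shows "even (card {(m, j). m \<in> {- int (n div 6)..int (n div 6)} \<and> j \<in> {1..n} \<and>
    n = nat (3 * m * (3 * m + 1)) + 2 * j\<^sup>2})" (is "even (card ?T)")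
proof -
  let ?Y = "{(m :: int, k :: int). 3 * m * (3 * m + 1) + 2 * (3 * k + 2)\<^sup>2 = int n}"
  have nonneg: "3 * m * (3 * m + 1) \<ge> 6 * \<bar>m\<bar>" for m :: int
  proof -
    have "\<bar>m\<bar> * 1 \<le> \<bar>m\<bar> * \<bar>m\<bar>"
      using mult_left_mono[of 1 "\<bar>m\<bar>" "\<bar>m\<bar>"] by (cases "m = 0") simp_all
    then show ?thesis by (simp add: algebra_simps)
  qed
  have inj: "k = k'" if "nat \<bar>3 * k + 2\<bar> = nat \<bar>3 * k' + 2\<bar>" for k k' :: int
  proof -
    have "\<bar>3 * k + 2\<bar> = \<bar>3 * k' + 2\<bar>"
      using that by simp
    then have "3 * k + 2 = 3 * k' + 2 \<or> 3 * k + 2 = - (3 * k' + 2)"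
      by (simp only: abs_eq_iff)
    then show ?thesis by presburger
  qed
  have "bij_betw (\<lambda>(m, k). (m, nat \<bar>3 * k + 2\<bar>)) ?Y ?T"
  proof (rule bij_betw_imageI)
    show "inj_on (\<lambda>(m, k). (m, nat \<bar>3 * k + 2\<bar>)) ?Y"
      using inj by (auto intro!: inj_onI)
  next
    show "(\<lambda>(m, k). (m, nat \<bar>3 * k + 2\<bar>)) ` ?Y = ?T"
    proof (intro equalityI subsetI)
      fix p assume "p \<in> (\<lambda>(m, k). (m, nat \<bar>3 * k + 2\<bar>)) ` ?Y"
      then obtain m k where p: "p = (m, nat \<bar>3 * k + 2\<bar>)"
        and eq: "3 * m * (3 * m + 1) + 2 * (3 * k + 2)\<^sup>2 = int n"
        by auto
      define j where "j = nat \<bar>3 * k + 2\<bar>"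
      have "3 * k + 2 \<noteq> 0" by presburger
      then have j: "(int j)\<^sup>2 = (3 * k + 2)\<^sup>2" "j \<ge> 1"
        by (simp_all add: j_def)
      have "int j \<le> (int j)\<^sup>2"
        using j(2) by (simp add: power2_eq_square)
      then have "int j \<le> int n" "6 * \<bar>m\<bar> \<le> int n"
        using eq j nonneg[of m] by linarith+
      then have "m \<in> {- int (n div 6)..int (n div 6)}" "j \<in> {1..n}"
        using j(2) by auto
      moreover have "int n = int (nat (3 * m * (3 * m + 1)) + 2 * j\<^sup>2)"
        using eq j nonneg[of m] by simp
      then have "n = nat (3 * m * (3 * m + 1)) + 2 * j\<^sup>2"
        by linarith
      ultimately show "p \<in> ?T"
        unfolding p j_def [symmetric] mem_Collect_eq prod.case by blast
    next
      fix p assume "p \<in> ?T"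
      then obtain m j where p: "p = (m, j)" and n_eq: "n = nat (3 * m * (3 * m + 1)) + 2 * j\<^sup>2"
        by auto
      then have eq: "int n = 3 * m * (3 * m + 1) + 2 * (int j)\<^sup>2"
        using nonneg[of m] by simp
      have "\<not> 3 dvd int j"
      proof
        assume "3 dvd int j"
        then have "3 dvd int n"
          unfolding eq by (simp add: power2_eq_square)
        then show False using n by presburger
      qed
      then have "\<exists>k. int j = 3 * k + 2 \<or> int j = - (3 * k + 2)"
        by presburger
      then obtain k where k: "int j = 3 * k + 2 \<or> int j = - (3 * k + 2)" ..
      then have "(int j)\<^sup>2 = (3 * k + 2)\<^sup>2"
        by (simp only: power2_eq_iff)
      moreover have "j = nat \<bar>3 * k + 2\<bar>"
        using k by linarith
      ultimately show "p \<in> (\<lambda>(m, k). (m, nat \<bar>3 * k + 2\<bar>)) ` ?Y"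
        using eq p by (auto simp: image_iff)
    qed
  qed
  then have "card ?Y = card ?T"
    by (rule bij_betw_same_card)
  then show ?thesis
    using even_card_form_solutions[OF n] by (simp only:)
qed

subsection \<open>The congruence modulo 8\<close>

text \<open>Cross terms occur twice; this reduces the square of the theta sum modulo 2.\<close>

lemma sum_power2_dvd:
  fixes f :: "'a \<Rightarrow> 'b :: comm_ring_1"
  assumes "finite A"
  shows "2 dvd (\<Sum>x\<in>A. f x)\<^sup>2 - (\<Sum>x\<in>A. (f x)\<^sup>2)"
  using assms
proof (induction A)
  case (insert x A)
  have "(\<Sum>x\<in>insert x A. f x)\<^sup>2 - (\<Sum>x\<in>insert x A. (f x)\<^sup>2) =
      2 * (f x * sum f A) + ((\<Sum>x\<in>A. f x)\<^sup>2 - (\<Sum>x\<in>A. (f x)\<^sup>2))"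
    using insert.hyps by (simp add: power2_eq_square algebra_simps)
  then show ?case
    using insert.IH by (metis dvd_add dvd_triv_left)
qed simp

lemma fps_nth_eq_0_if_X_power_dvd:
  fixes f :: "'a :: comm_ring_1 fps"
  assumes "fps_X ^ n dvd f" "i < n"
  shows "fps_nth f i = 0"
proof -
  obtain h where "f = fps_X ^ n * h"
    using assms(1) by (elim dvdE)
  then show ?thesis
    using assms(2) by (simp add: fps_X_power_mult_nth)
qed

lemma fps_nth_dvd_if_dvd:
  assumes "of_int c dvd (f :: int fps)"
  shows "c dvd fps_nth f i"
proof -
  obtain h where "f = of_int c * h"
    using assms by (elim dvdE)
  moreover have "of_int c = fps_const c"
    by (simp flip: fps_of_int)
  ultimately show ?thesis
    by simp
qed

lemma R_star_bar_6_dvd_8: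
  assumes n: "n mod 9 = 5 \<or> n mod 9 = 8"
  shows "8 dvd R_star_bar 6 n"
proof -
  define \<tau> :: "int fps" where "\<tau> = (\<Sum>j\<in>{1..n}. (-1) ^ j * fps_X ^ j\<^sup>2)"
  define g where "g = (\<Prod>k\<in>{1..n}. 1 + fps_X ^ k) * partition_fps {k \<in> {1..n}. \<not> 6 dvd k}"
  define K where "K = int (n div 6)"
  define e where "e m = nat (3 * m * (3 * m + 1))" for m :: int
  define E :: "int fps" where "E = (\<Sum>m\<in>{-K..K}. (-1) ^ nat \<bar>m\<bar> * fps_X ^ e m)"
  define E' :: "int fps" where "E' = (\<Sum>m\<in>{-K..K}. fps_X ^ e m)"
  define \<tau>' :: "int fps" where "\<tau>' = (\<Sum>j\<in>{1..n}. fps_X ^ (2 * j\<^sup>2))"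
  have e3: "3 dvd e m" for m
  proof -
    have "3 * m * (3 * m + 1) = 3 * (m * (3 * m + 1))" by simp
    then show ?thesis
      unfolding e_def by (metis dvd_triv_left nat_dvd_iff nat_mult_distrib nat_numeral zero_le_numeral)
  qed
  have n3: "n mod 3 = 2"
    using n by presburger
  have sq3: "(3 * a + j\<^sup>2 :: nat) \<noteq> n" for a j
  proof -
    have "j\<^sup>2 mod 3 = (j mod 3)\<^sup>2 mod 3"
      by (simp add: power_mod)
    moreover have "j mod 3 = 0 \<or> j mod 3 = 1 \<or> j mod 3 = 2"
      by presburger
    ultimately have "j\<^sup>2 mod 3 \<noteq> 2"
      by auto
    then show ?thesis using n3 by presburger
  qed
  have e6: "6 * nat (m * (3 * m + 1) div 2) = e m" for m :: int
  proof -
    have "even (m * (3 * m + 1))" by auto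
    then obtain c where c: "m * (3 * m + 1) = 2 * c" by blast
    then have "3 * m * (3 * m + 1) = 6 * c" by simp
    then show ?thesis
      by (simp only: e_def c) (simp add: nat_mult_distrib)
  qed
  \<comment> \<open>Truncation at \<open>N = n\<close> keeps the coefficient of index
    \<open>n\<close> exact.\<close>
  have "fps_X ^ Suc n dvd g * (1 + 2 * \<tau>) - E"
    using R_star_bar_generating_function_mod[of 6 n]
    unfolding g_def \<tau>_def E_def K_def by (simp flip: power_mult add: e6 del: power_Suc)
  \<comment> \<open>The multiplier inverts \<open>1 + 2 * \<tau>\<close> modulo 8: their product is
    \<open>1 + 8 * \<tau> ^ 3\<close>.\<close>
  then have "fps_X ^ Suc n dvd (g * (1 + 2 * \<tau>) - E) * (1 - 2 * \<tau> + 4 * \<tau>\<^sup>2)"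
    by (rule dvd_mult2)
  also have "(g * (1 + 2 * \<tau>) - E) * (1 - 2 * \<tau> + 4 * \<tau>\<^sup>2) =
      g + 8 * (g * \<tau> ^ 3) - E + 2 * (E * \<tau>) - 4 * (E * \<tau>\<^sup>2)"
    by (simp add: algebra_simps power2_eq_square power3_eq_cube)
  finally have "fps_nth (g + 8 * (g * \<tau> ^ 3) - E + 2 * (E * \<tau>) - 4 * (E * \<tau>\<^sup>2)) n = 0"
    by (rule fps_nth_eq_0_if_X_power_dvd) simp
  moreover have "fps_nth E n = 0"
  proof -
    have "e m \<noteq> n" for m
      using e3[of m] n3 by auto
    then show ?thesis
      unfolding E_def fps_sum_nth
      by (intro sum.neutral) (auto simp: minus_one_power_iff)
  qed
  moreover have "fps_nth (E * \<tau>) n = 0"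
  proof -
    have "n \<noteq> e m + j\<^sup>2" for m j
      using e3[of m] sq3 by (metis dvdE)
    then have "fps_nth ((-1) ^ i * fps_X ^ (e m + j\<^sup>2) :: int fps) n = 0" for i m j
      by (simp add: minus_one_power_iff)
    moreover have "E * \<tau> = (\<Sum>m\<in>{-K..K}. \<Sum>j\<in>{1..n}. (-1) ^ (nat \<bar>m\<bar> + j) * fps_X ^ (e m + j\<^sup>2))"
      unfolding E_def \<tau>_def sum_product by (simp add: power_add mult_ac)
    ultimately show ?thesis
      by (simp only: fps_sum_nth sum.neutral_const)
  qed
  moreover have "even (fps_nth (E * \<tau>\<^sup>2) n)"
  proof -
    \<comment> \<open>Modulo 2 all signs drop out, so \<open>E * \<tau>\<^sup>2\<close> may be
      replaced by \<open>E' * \<tau>'\<close>, whose coefficient counts the pairs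
      \<open>(m, j)\<close>.\<close>
    have "2 dvd E - E'"
      unfolding E_def E'_def sum_subtractf [symmetric]
      by (intro dvd_sum) (auto simp: minus_one_power_iff)
    moreover have "2 dvd \<tau>\<^sup>2 - \<tau>'"
      using sum_power2_dvd[of "{1..n}" "\<lambda>j. (-1) ^ j * fps_X ^ j\<^sup>2 :: int fps"]
      by (simp add: \<tau>_def \<tau>'_def power_mult_distrib mult.commute flip: power_mult)
    ultimately have "2 dvd (E - E') * \<tau>\<^sup>2 + E' * (\<tau>\<^sup>2 - \<tau>')"
      by (intro dvd_add dvd_mult dvd_mult2)
    also have "(E - E') * \<tau>\<^sup>2 + E' * (\<tau>\<^sup>2 - \<tau>') = E * \<tau>\<^sup>2 - E' * \<tau>'"
      by (simp add: algebra_simps)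
    finally have "even (fps_nth (E * \<tau>\<^sup>2) n - fps_nth (E' * \<tau>') n)"
      using fps_nth_dvd_if_dvd[of 2 "E * \<tau>\<^sup>2 - E' * \<tau>'" n] by simp
    moreover have "fps_nth (E' * \<tau>') n =
        (\<Sum>(m, j)\<in>{-K..K} \<times> {1..n}. if n = e m + 2 * j\<^sup>2 then 1 else 0)"
      unfolding E'_def \<tau>'_def sum_product
      by (simp add: fps_sum_nth sum.cartesian_product case_prod_unfold flip: power_add)
    moreover have "\<dots> = int (card {(m, j). m \<in> {-K..K} \<and> j \<in> {1..n} \<and> n = e m + 2 * j\<^sup>2})"
      by (simp add: case_prod_unfold sum.If_cases) (intro arg_cong[where f = card], auto)
    ultimately show ?thesis
      using even_card_natural_solutions[OF n] unfolding K_def e_def by simp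
  qed
  moreover have "8 dvd fps_nth (8 * (g * \<tau> ^ 3)) n"
    by (rule fps_nth_dvd_if_dvd) simp
  moreover have "4 * fps_nth (E * \<tau>\<^sup>2) n = fps_nth (4 * (E * \<tau>\<^sup>2)) n" "fps_nth (2 * (E * \<tau>)) n = 2 * fps_nth (E * \<tau>) n"
    by (simp_all add: numeral_fps_const)
  ultimately have "8 dvd fps_nth g n"
    by simp presburger
  then have "8 dvd int (R_star_bar 6 n)"
    unfolding g_def by (simp add: R_star_bar_eq_fps_nth[of n n 6])
  then show ?thesis
    by presburger
qed

theorem theorem1p9:
  fixes n :: nat
  shows "[R_star_bar 6 (9 * n + 5) = 0] (mod 8) \<and> [R_star_bar 6 (9 * n + 8) = 0] (mod 8)"
  using R_star_bar_6_dvd_8[of "9 * n + 5"] R_star_bar_6_dvd_8[of "9 * n + 8"]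
  by (simp add: cong_0_iff)

end
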